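(* Let $(B,+,\cdot)$ be a skew left brace with additive group $K$, multiplicative group $C$ and identity map $\delta\colon C\to K$. Let $(G,K,H,E)$ be a trifactorised group associated with $(B,+,\cdot)$ with corresponding epimorphism $\eta\colon C\to E$. Let $I$ be an ideal of $B$, corresponding to the subgroup $L\le K$, and let $T=LH\cap LE$. Then the trifactorised group $(G/T,KT/T,HT/T,ET/T)$ is associated with the quotient brace $(B/I,+,\cdot)$, with epimorphism $\bar\eta\colon\overline{C}\to\overline{E}$ given by $\bar\eta(cD)=\eta(c)T$, where $D=\delta^{-1}(L)$, $\overline{C}=C/D$ and $\overline{E}=ET/T$.
   Context: A skew left brace $(B,+,\cdot)$ is a set with two group operations ($+$ not necessarily commutative) such that $a(b+c)=ab-a+ac$ for all $a,b,c\in B$. Its lambda map is the homomorphism $\lambda\colon (B,\cdot)\to\operatorname{Aut}(B,+)$, $\lambda_a(b)=-a+ab$. An ideal is a subset $I$ that is a normal subgroup of $(B,+)$ and of $(B,\cdot)$ with $\lambda_a(I)\subseteq I$ for all $a\in B$; then $B/I$ is naturally a skew left brace. A trifactorised group is a tuple $(G,K,H,E)$ with $G$ a group, $K\trianglelefteq G$, $H,E\le G$, $G=KE=KH=HE$ and $K\cap E=H\cap E=1$. Trifactorised groups associated with a brace: let $K=(B,+)$, $C=(B,\cdot)$, let $\delta\colon C\to K$ be the identity map of $B$, and let $\eta\colon C\to E$ be a surjective group homomorphism with $\ker\eta\le\ker\lambda$. Then $E$ acts on $K$ by $\bar\lambda(\eta(c))=\lambda(c)$; put $G=K\rtimes E$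 and $H=\{\delta(c)\eta(c)\mid c\in C\}\le G$. The tuple $(G,K,H,E)$ is the trifactorised group associated with $B$ with corresponding epimorphism $\eta$. Here $K$, $E$ are identified with their copies in $G$, and an internal semidirect product $KE$ is identified with the external one via $(k,e)\mapsto ke$. $L$ is the set $I$ regarded as a subgroup of $K\le G$, and $D$ is the set $I$ regarded as a subgroup of $C$. $T$ is a normal subgroup of $G$ with $T\cap K=L$, and the additive group $K/L$ of $B/I$ is identified with $KT/T$ via $kL\mapsto kT$; "associated with $B/I$" is with respect to this identification. The multiplicative group of $B/I$ is $C/D$. *)

theory Defs
  imports "HOL-Algebra.AbelCoset" "HOL-Algebra.Bij"
begin

section \<open>Skew left braces\<close>

text \<open>A skew left brace is carried by the record type of rings: its additive group is
  \<^term>\<open>add_monoid B\<close> and its multiplicative group is \<^term>\<open>B\<close> itself. The addition is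
  not assumed to be commutative.\<close>

locale skew_brace =
  fixes B (structure)
  assumes additive_group: "group (add_monoid B)"
    and multiplicative_group: "group B"
    and brace_distrib: "\<lbrakk>a \<in> carrier B; b \<in> carrier B; c \<in> carrier B\<rbrakk> \<Longrightarrow>
      a \<otimes> (b \<oplus> c) = (a \<otimes> b \<ominus> a) \<oplus> a \<otimes> c"

text \<open>Restricted to the carrier because the elements of \<^term>\<open>AutoGroup (add_monoid B)\<close> are
  extensional functions.\<close>

definition brace_lambda :: "('a, 'b) ring_scheme \<Rightarrow> 'a \<Rightarrow> 'a \<Rightarrow> 'a"
  where "brace_lambda B a = (\<lambda>b \<in> carrier B. \<ominus>\<^bsub>B\<^esub> a \<oplus>\<^bsub>B\<^esub> a \<otimes>\<^bsub>B\<^esub> b)"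

definition brace_ideal :: "'a set \<Rightarrow> ('a, 'b) ring_scheme \<Rightarrow> bool"
  where "brace_ideal I B \<longleftrightarrow> I \<lhd> add_monoid B \<and> I \<lhd> B \<and>
    (\<forall>a \<in> carrier B. brace_lambda B a ` I \<subseteq> I)"

text \<open>The additive and the multiplicative cosets of an ideal coincide, so the multiplicative
  group of the quotient is \<^term>\<open>B Mod I\<close> (see \<open>truncate_brace_quotient\<close> below).\<close>

definition brace_quotient :: "('a, 'b) ring_scheme \<Rightarrow> 'a set \<Rightarrow> 'a set ring"
  where "brace_quotient B I =
    \<lparr>carrier = a_rcosets\<^bsub>B\<^esub> I, mult = set_mult B, one = I, zero = I, add = set_add B\<rparr>"

lemma truncate_brace_quotient:
  fixes B (structure)
  assumes "skew_brace B" and I: "brace_ideal I B"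
  shows "monoid.truncate (brace_quotient B I) = B Mod I"
proof -
  interpret skew_brace B by fact
  interpret A: group "add_monoid B" by (rule additive_group)
  interpret M: group B by (rule multiplicative_group)
  interpret AI: normal I "add_monoid B" using I by (simp add: brace_ideal_def)
  interpret MI: normal I B using I by (simp add: brace_ideal_def)
  have AI_sub: "I \<subseteq> carrier B" by (rule MI.subset)
  have one: "\<one> = \<zero>"
  proof -
    have z: "\<zero> \<in> carrier B" using A.one_closed by simp
    have "\<one> \<otimes> (\<zero> \<oplus> \<zero>) = (\<one> \<otimes> \<zero> \<ominus> \<one>) \<oplus> \<one> \<otimes> \<zero>"
      by (intro brace_distrib) (use z in auto)
    then have "\<zero> = (\<ominus> \<one>) \<oplus> \<zero>"
      using z A.l_one[of \<zero>] A.l_one[of "\<ominus> \<one>"] A.inv_closed[of \<one>]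
      by (simp add: a_minus_def a_inv_def)
    then have "\<ominus> \<one> = \<zero>" using A.r_one[of "\<ominus> \<one>"] A.inv_closed[of \<one>]
      by (simp add: a_inv_def)
    then show ?thesis using A.inv_inv[of \<one>] A.inv_one by (simp add: a_inv_def)
  qed
  have mult: "a \<otimes> b = a \<oplus> brace_lambda B a b" if "a \<in> carrier B" "b \<in> carrier B" for a b
    using that A.inv_solve_left'[of a "a \<otimes> b"] A.m_assoc[of a "inv\<^bsub>add_monoid B\<^esub> a" "a \<otimes> b"]
      A.r_inv[of a] A.l_one[of "a \<otimes> b"] A.inv_closed[of a]
    by (simp add: brace_lambda_def a_inv_def)
  have lam_closed: "brace_lambda B a b \<in> I" if "a \<in> carrier B" "b \<in> I" for a b
    using I that by (auto simp: brace_ideal_def)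
  have sub: "a <# I \<subseteq> a <+ I" if "a \<in> carrier B" for a
  proof
    fix x assume "x \<in> a <# I"
    then obtain i where i: "i \<in> I" "x = a \<otimes> i" by (auto simp: l_coset_def)
    moreover have "i \<in> carrier B" using i AI_sub by auto
    ultimately show "x \<in> a <+ I"
      using mult[OF that] lam_closed[OF that] by (auto simp: a_l_coset_def l_coset_def)
  qed
  have add: "a \<oplus> b = a \<otimes> brace_lambda B (inv a) b"
    if "a \<in> carrier B" "b \<in> carrier B" for a b
  proof -
    have ia: "inv a \<in> carrier B" using that by simp
    have "inv a \<otimes> (a \<oplus> b) = (inv a \<otimes> a \<ominus> (inv a)) \<oplus> inv a \<otimes> b"
      by (rule brace_distrib) (use that in auto)
    also have "\<dots> = brace_lambda B (inv a) b"
      using that ia one A.l_one[of "\<ominus> (inv a)"] A.inv_closed[of "inv a"]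
      by (simp add: brace_lambda_def a_minus_def a_inv_def)
    finally show ?thesis
      using that A.m_closed[of a b] M.inv_solve_left[of "a" "brace_lambda B (inv a) b" "a \<oplus> b"]
      by (metis M.inv_closed M.l_inv M.l_one M.m_assoc M.r_inv monoid.simps(1) partial_object.select_convs(1))
  qed
  have eq: "a <# I = a <+ I" if "a \<in> carrier B" for a
  proof (rule equalityI[OF sub[OF that]])
    show "a <+ I \<subseteq> a <# I"
    proof
      fix x assume "x \<in> a <+ I"
      then obtain i where i: "i \<in> I" "x = a \<oplus> i" by (auto simp: a_l_coset_def l_coset_def)
      moreover have "i \<in> carrier B" using i AI_sub by auto
      ultimately show "x \<in> a <# I"
        using add[OF that] lam_closed[of "inv a" i] that by (auto simp: l_coset_def)
    qed
  qed
  have "a_rcosets I = rcosets I"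
    using eq AI.coset_eq MI.coset_eq
    by (auto simp: A_RCOSETS_def RCOSETS_def a_l_coset_def)
  then show ?thesis
    by (simp add: brace_quotient_def FactGroup_def monoid.truncate_def)
qed


section \<open>Trifactorised groups\<close>

locale trifactorised_group =
  fixes G (structure) and K H E
  assumes K_normal: "K \<lhd> G"
    and H_subgroup: "subgroup H G"
    and E_subgroup: "subgroup E G"
    and factor_KE: "carrier G = K <#> E"
    and factor_KH: "carrier G = K <#> H"
    and factor_HE: "carrier G = H <#> E"
    and K_Int_E: "K \<inter> E = {\<one>}"
    and H_Int_E: "H \<inter> E = {\<one>}"

definition semidirect_product ::
  "('a, 'm) monoid_scheme \<Rightarrow> ('e, 'n) monoid_scheme \<Rightarrow> ('e \<Rightarrow> 'a \<Rightarrow> 'a) \<Rightarrow> ('a \<times> 'e) monoid"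
  where "semidirect_product K E act =
    \<lparr>carrier = carrier K \<times> carrier E,
     mult = (\<lambda>(k, e) (k', e'). (k \<otimes>\<^bsub>K\<^esub> act e k', e \<otimes>\<^bsub>E\<^esub> e')),
     one = (\<one>\<^bsub>K\<^esub>, \<one>\<^bsub>E\<^esub>)\<rparr>"

text \<open>The action sending \<open>\<eta> c\<close> to \<^term>\<open>brace_lambda B c\<close>; it is well defined when the kernel
  of \<open>\<eta>\<close> is contained in the kernel of \<^term>\<open>brace_lambda B\<close>.\<close>

definition induced_action ::
  "('a, 'b) ring_scheme \<Rightarrow> ('a \<Rightarrow> 'e) \<Rightarrow> 'e \<Rightarrow> 'a \<Rightarrow> 'a"
  where "induced_action B \<eta> e = the_elem (brace_lambda B ` {c \<in> carrier B. \<eta> c = e})"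

text \<open>\<open>\<delta>\<close> is the identity map of \<open>B\<close>, viewed as a map from the multiplicative group to the
  subgroup \<open>K\<close> of \<open>G\<close> with which the additive group is identified; the same function is
  therefore the isomorphism from the additive group onto \<open>K\<close> that realises the
  identification. The group \<open>G\<close> is the semidirect product of \<open>K\<close> and \<open>E\<close>, via the
  identification of \<open>(k, e)\<close> with the product \<open>ke\<close>.\<close>

locale brace_trifactorised_group = skew_brace B + trifactorised_group G K H E
  for B :: "('a, 'b) ring_scheme" and G :: "('g, 'm) monoid_scheme" and K H E +
  fixes \<delta> \<eta> :: "'a \<Rightarrow> 'g"
  assumes delta_iso: "\<delta> \<in> iso (add_monoid B) (G\<lparr>carrier := K\<rparr>)"
    and eta_epi: "\<eta> \<in> epi B (G\<lparr>carrier := E\<rparr>)"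
    and kernel_eta: "kernel B (G\<lparr>carrier := E\<rparr>) \<eta>
      \<subseteq> kernel B (AutoGroup (add_monoid B)) (brace_lambda B)"
    and semidirect: "(\<lambda>(k, e). \<delta> k \<otimes>\<^bsub>G\<^esub> e)
      \<in> iso (semidirect_product (add_monoid B) (G\<lparr>carrier := E\<rparr>) (induced_action B \<eta>)) G"
    and H_eq: "H = {\<delta> c \<otimes>\<^bsub>G\<^esub> \<eta> c | c. c \<in> carrier B}"

text \<open>The subset \<open>XT/T\<close> of \<open>G/T\<close>.\<close>

definition image_mod :: "('g, 'm) monoid_scheme \<Rightarrow> 'g set \<Rightarrow> 'g set \<Rightarrow> 'g set set"
  where "image_mod G X T = carrier (G\<lparr>carrier := X <#>\<^bsub>G\<^esub> T\<rparr> Mod T)"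

end

theory Submission
  imports Defs
begin

text \<open>
  The heart of the matter is a conjugation formula. Inside \<open>G\<close>, the action of \<open>E\<close> on \<open>K\<close> is
  conjugation, so a trifactorised group of a brace satisfies
  \<open>\<eta> c \<cdot> \<delta> b = \<delta> (\<lambda>\<^sub>c b) \<cdot> \<eta> c\<close>. Conversely, if \<open>G = KE\<close> with \<open>K\<close> normal and \<open>K \<inter> E = 1\<close>, then
  this formula alone forces everything else: \<open>c \<mapsto> \<delta> c \<cdot> \<eta> c\<close> is a homomorphism from the
  multiplicative group, so its image \<open>H\<close> is a subgroup, both further factorisations hold,
  the kernel of \<open>\<eta>\<close> acts trivially, and \<open>G\<close> is the semidirect product. The locale
  \<open>brace_factorisation\<close> packages this internal description; the equivalence consists of the
  facts \<open>brace_factorisation.brace_trifactorised_group\<close> and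
  \<open>brace_trifactorised_group.brace_factorisation\<close>.

  The internal description passes to quotients easily, because it consists of identities
  between elements. By uniqueness of the factorisation \<open>G = KE\<close>, an element
  \<open>\<delta> a \<cdot> \<delta> c \<cdot> \<eta> c\<close> of \<open>LH\<close> lies in \<open>LE\<close> exactly when \<open>c \<in> I\<close>, whence
  \<open>T = {\<delta> a \<cdot> \<eta> b | a, b \<in> I}\<close>. This set is a normal subgroup: closure under the operations
  and under conjugation by \<open>E\<close> uses that \<open>I\<close> is \<open>\<lambda>\<close>-invariant and normal in the multiplicative
  group; conjugation by \<open>K\<close> needs in addition that \<open>\<lambda>\<^sub>i\<close> induces the identity modulo \<open>I\<close> for
  \<open>i \<in> I\<close> (\<open>lambda_of_ideal\<close>). From the explicit form of \<open>T\<close> one reads off that \<open>T \<inter> K = L\<close>, so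
  that \<open>KT/T\<close> is a copy of the additive group of \<open>B/I\<close>, that \<open>KT/T\<close> and \<open>ET/T\<close> meet
  trivially, and that \<open>\<eta>\<close> maps \<open>I\<close> into \<open>T\<close>. The conjugation formula for \<open>B/I\<close> is the image
  modulo \<open>T\<close> of the one for \<open>B\<close>.
\<close>

section \<open>Cosets of a normal subgroup\<close>

lemma (in normal) l_coset_eq_iff:
  assumes x: "x \<in> carrier G" and y: "y \<in> carrier G"
  shows "x <# H = y <# H \<longleftrightarrow> inv x \<otimes> y \<in> H"
proof -
  have "x <# H = y <# H \<longleftrightarrow> y \<in> x <# H"
    using x y repr_independence [of y H x] repr_independenceD [of H y x]
      subgroup_axioms coset_eq by metis
  also have "\<dots> \<longleftrightarrow> inv x \<otimes> y \<in> H"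
  proof
    assume "inv x \<otimes> y \<in> H"
    moreover have "y = x \<otimes> (inv x \<otimes> y)" using x y by (simp add: m_assoc [symmetric])
    ultimately show "y \<in> x <# H" unfolding l_coset_def by blast
  qed (use x in \<open>auto simp: l_coset_def m_assoc [symmetric]\<close>)
  finally show ?thesis .
qed

lemma (in normal) l_coset_mult:
  assumes "x \<in> carrier G" "y \<in> carrier G"
  shows "(x <# H) <#> (y <# H) = (x \<otimes> y) <# H"
  using assms rcos_sum [of x y] by (simp add: coset_eq)

lemma (in normal) image_mod_eq:
  assumes X: "X \<subseteq> carrier G"
  shows "image_mod G X H = (\<lambda>x. x <# H) ` X"
proof -
  have coset: "H #> (x \<otimes> h) = x <# H" if "x \<in> X" "h \<in> H" for x h
  proof -
    have "x \<in> carrier G" using that X by auto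
    moreover have "inv x \<otimes> (x \<otimes> h) \<in> H"
      using \<open>x \<in> carrier G\<close> that by (simp add: m_assoc [symmetric])
    ultimately show ?thesis
      using that l_coset_eq_iff [of x "x \<otimes> h"] by (simp add: coset_eq)
  qed
  have "image_mod G X H = (\<Union>x\<in>X. \<Union>h\<in>H. {H #> (x \<otimes> h)})"
    by (auto simp: image_mod_def FactGroup_def RCOSETS_def set_mult_def r_coset_def)
  also have "\<dots> = (\<Union>x\<in>X. \<Union>h\<in>H. {x <# H})"
    by (intro SUP_cong refl) (simp add: coset)
  also have "\<dots> = (\<lambda>x. x <# H) ` X"
    using subgroup.one_closed [OF subgroup_axioms] by blast
  finally show ?thesis .
qed

section \<open>The lambda map of a skew left brace\<close>

context skew_brace
begin

sublocale add: group "add_monoid B"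
  rewrites "carrier (add_monoid B) = carrier B"
    and "monoid.mult (add_monoid B) = add B"
    and "one (add_monoid B) = zero B"
    and "m_inv (add_monoid B) = a_inv B"
  by (rule additive_group) (auto simp: a_inv_def)

sublocale mul: group B
  by (rule multiplicative_group)

lemma lambda_eq:
  "a \<in> carrier B \<Longrightarrow> b \<in> carrier B \<Longrightarrow> brace_lambda B a b = \<ominus> a \<oplus> a \<otimes> b"
  by (simp add: brace_lambda_def)

lemma lambda_closed [simp]:
  "a \<in> carrier B \<Longrightarrow> b \<in> carrier B \<Longrightarrow> brace_lambda B a b \<in> carrier B"
  by (simp add: lambda_eq)

lemma mult_eq_add_lambda:
  assumes "a \<in> carrier B" "b \<in> carrier B"
  shows "a \<otimes> b = a \<oplus> brace_lambda B a b"
  using assms by (simp add: lambda_eq add.m_assoc [symmetric])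

lemma mult_add_distrib:
  assumes "a \<in> carrier B" "b \<in> carrier B" "c \<in> carrier B"
  shows "a \<otimes> (b \<oplus> c) = a \<otimes> b \<oplus> brace_lambda B a c"
  using assms by (simp add: brace_distrib a_minus_def lambda_eq add.m_assoc)

lemma lambda_add:
  assumes "a \<in> carrier B" "b \<in> carrier B" "c \<in> carrier B"
  shows "brace_lambda B a (b \<oplus> c) = brace_lambda B a b \<oplus> brace_lambda B a c"
  using assms by (simp add: lambda_eq [of a] mult_add_distrib add.m_assoc)

lemma lambda_mult:
  assumes "a \<in> carrier B" "b \<in> carrier B" "c \<in> carrier B"
  shows "brace_lambda B (a \<otimes> b) c = brace_lambda B a (brace_lambda B b c)"
proof -
  have "a \<otimes> b \<otimes> c = a \<otimes> (b \<oplus> brace_lambda B b c)"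
    using assms by (simp add: mul.m_assoc mult_eq_add_lambda [of b])
  also have "\<dots> = a \<otimes> b \<oplus> brace_lambda B a (brace_lambda B b c)"
    using assms by (simp add: mult_add_distrib)
  finally show ?thesis
    using assms by (simp add: lambda_eq [of "a \<otimes> b"] add.m_assoc [symmetric])
qed

lemma lambda_zero:
  assumes "a \<in> carrier B" shows "brace_lambda B a \<zero> = \<zero>"
proof -
  have "brace_lambda B a \<zero> \<oplus> brace_lambda B a \<zero> = brace_lambda B a \<zero>"
    using lambda_add [OF assms, of \<zero> \<zero>] by simp
  then show ?thesis using assms by simp
qed

lemma one_eq_zero: "\<one> = \<zero>"
proof -
  have "\<one> \<otimes> \<zero> = \<one> \<oplus> \<zero>"
    unfolding mult_eq_add_lambda [OF mul.one_closed add.one_closed] by (simp add: lambda_zero)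
  then show ?thesis by simp
qed

end

section \<open>Quotients of skew left braces\<close>

locale skew_brace_ideal = skew_brace B
  for B (structure) + fixes I
  assumes ideal: "brace_ideal I B"
begin

sublocale add: normal I "add_monoid B"
  rewrites "carrier (add_monoid B) = carrier B"
    and "monoid.mult (add_monoid B) = add B"
    and "one (add_monoid B) = zero B"
    and "m_inv (add_monoid B) = a_inv B"
    and "r_coset (add_monoid B) = a_r_coset B"
    and "l_coset (add_monoid B) = a_l_coset B"
    and "set_mult (add_monoid B) = set_add B"
  using ideal by (auto simp: brace_ideal_def a_inv_def a_r_coset_def a_l_coset_def set_add_def)

sublocale mul: normal I B
  using ideal by (simp add: brace_ideal_def)

lemma lambda_ideal: "a \<in> carrier B \<Longrightarrow> i \<in> I \<Longrightarrow> brace_lambda B a i \<in> I"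
  using ideal by (auto simp: brace_ideal_def)

text \<open>Elements of the ideal act trivially on the additive quotient: moving \<open>i\<close> past \<open>b\<close> in the
  multiplicative group turns \<open>ib\<close> into \<open>bj\<close> with \<open>j \<in> I\<close>, and \<open>bj = b + \<lambda>\<^sub>b j\<close> is congruent to
  \<open>b\<close>.\<close>

lemma lambda_of_ideal:
  assumes i: "i \<in> I" and b: "b \<in> carrier B"
  shows "\<ominus> b \<oplus> brace_lambda B i b \<in> I"
proof -
  define j where "j = inv b \<otimes> i \<otimes> b"
  have j: "j \<in> I" using i b by (simp add: j_def mul.inv_op_closed1)
  have [simp]: "i \<in> carrier B" "j \<in> carrier B" using i j by auto
  have "i \<otimes> b = b \<otimes> j" using b by (simp add: j_def mul.m_assoc [symmetric])
  also have "\<dots> = b \<oplus> brace_lambda B b j" using b by (simp add: mult_eq_add_lambda)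
  finally have "\<ominus> b \<oplus> brace_lambda B i b = (\<ominus> b \<oplus> \<ominus> i \<oplus> b) \<oplus> brace_lambda B b j"
    using b by (simp add: lambda_eq [of i] add.m_assoc)
  moreover have "\<ominus> b \<oplus> \<ominus> i \<oplus> b \<in> I" using b i by (simp add: add.inv_op_closed1)
  ultimately show ?thesis using j b by (simp add: lambda_ideal)
qed

abbreviation Q where "Q \<equiv> brace_quotient B I"

lemma quotient_sel:
  "carrier Q = (\<lambda>a. a <+ I) ` carrier B" "zero Q = I" "one Q = I"
  "add Q = set_add B" "monoid.mult Q = set_mult B"
  by (auto simp: brace_quotient_def A_RCOSETS_def RCOSETS_def add.coset_eq simp flip: a_r_coset_def)

lemma quotient_add:
  "a \<in> carrier B \<Longrightarrow> b \<in> carrier B \<Longrightarrow> (a <+ I) \<oplus>\<^bsub>Q\<^esub> (b <+ I) = (a \<oplus> b) <+ I"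
  using add.rcos_sum [of a b] by (simp add: quotient_sel add.coset_eq)

lemma quotient_add_group_eq: "add_monoid Q = add_monoid B Mod I"
  by (simp add: brace_quotient_def FactGroup_def A_RCOSETS_def set_add_def)

lemma quotient_mult_group_eq: "monoid.truncate Q = B Mod I"
  using truncate_brace_quotient [OF skew_brace_axioms ideal] .

text \<open>The carrier of the quotient consists of the additive cosets, but equally of the
  multiplicative ones; two cosets of different kinds that share a representative are therefore
  the same set. This lets \<open>\<delta>\<close> and \<open>\<eta>\<close>, which are homomorphisms for different operations,
  descend to the same quotient.\<close>

lemma coset_eq_coset:
  assumes "a \<in> carrier B" shows "a <# I = a <+ I"
proof -
  have "carrier Q = rcosets I"
    using quotient_mult_group_eq by (auto simp: monoid.truncate_def FactGroup_def)
  then have "a <# I \<in> carrier Q"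
    using assms by (auto simp: RCOSETS_def mul.coset_eq)
  then obtain b where b: "b \<in> carrier B" "a <# I = b <+ I" by (auto simp: quotient_sel)
  have "a \<in> a <# I"
    using assms mul.rcos_self [of a I] mul.subgroup_axioms mul.coset_eq by auto
  then have "a \<in> I +> b" using b by (simp add: add.coset_eq)
  then have "I +> b = I +> a"
    using add.repr_independence [of a I b] b add.subgroup_axioms by (simp add: a_r_coset_def)
  then show ?thesis using b assms by (simp add: add.coset_eq)
qed

lemma quotient_mult:
  assumes "a \<in> carrier B" "b \<in> carrier B"
  shows "(a <+ I) \<otimes>\<^bsub>Q\<^esub> (b <+ I) = (a \<otimes> b) <+ I"
proof -
  have "(a <# I) <#> (b <# I) = (a \<otimes> b) <# I"
    using assms mul.rcos_sum [of a b] by (simp add: mul.coset_eq)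
  then show ?thesis using assms by (simp add: quotient_sel coset_eq_coset)
qed

lemma quotient_add_group: "group (add_monoid Q)"
  unfolding quotient_add_group_eq using add.factorgroup_is_group .

lemma quotient_minus:
  assumes a: "a \<in> carrier B"
  shows "\<ominus>\<^bsub>Q\<^esub> (a <+ I) = (\<ominus> a) <+ I"
proof -
  interpret QA: group "add_monoid Q" by (rule quotient_add_group)
  have "\<zero> <+ I = I" using add.coset_join3 [of \<zero> I] add.subgroup_axioms by (simp add: a_l_coset_def)
  then have "((\<ominus> a) <+ I) \<oplus>\<^bsub>Q\<^esub> (a <+ I) = \<zero>\<^bsub>Q\<^esub>"
    using a quotient_add [of "\<ominus> a" a] by (simp add: quotient_sel)
  then show ?thesis
    using a QA.inv_equality [of "(\<ominus> a) <+ I" "a <+ I"]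
    by (simp add: a_inv_def [of Q] quotient_sel)
qed

lemma skew_brace_quotient: "skew_brace Q"
proof (rule skew_brace.intro)
  show "group (add_monoid Q)" by (rule quotient_add_group)
  have "group (B Mod I)" by (rule mul.factorgroup_is_group)
  then interpret QM: group "monoid.truncate Q" by (simp add: quotient_mult_group_eq)
  show "group Q"
  proof (rule groupI)
    fix x assume "x \<in> carrier Q"
    then show "\<exists>y\<in>carrier Q. y \<otimes>\<^bsub>Q\<^esub> x = \<one>\<^bsub>Q\<^esub>"
      using QM.l_inv_ex [of x] by (simp add: monoid.truncate_def)
  next
    fix x y z assume "x \<in> carrier Q" "y \<in> carrier Q" "z \<in> carrier Q"
    then show "x \<otimes>\<^bsub>Q\<^esub> y \<otimes>\<^bsub>Q\<^esub> z = x \<otimes>\<^bsub>Q\<^esub> (y \<otimes>\<^bsub>Q\<^esub> z)"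
      using QM.m_assoc [of x y z] by (simp add: monoid.truncate_def)
  qed (use QM.m_closed QM.one_closed QM.l_one in \<open>simp_all add: monoid.truncate_def\<close>)
  fix x y z
  assume "x \<in> carrier Q" "y \<in> carrier Q" "z \<in> carrier Q"
  then obtain a b c where "a \<in> carrier B" "b \<in> carrier B" "c \<in> carrier B"
      and "x = a <+ I" "y = b <+ I" "z = c <+ I"
    by (auto simp: quotient_sel)
  then show "x \<otimes>\<^bsub>Q\<^esub> (y \<oplus>\<^bsub>Q\<^esub> z) = (x \<otimes>\<^bsub>Q\<^esub> y \<ominus>\<^bsub>Q\<^esub> x) \<oplus>\<^bsub>Q\<^esub> x \<otimes>\<^bsub>Q\<^esub> z"
    by (simp add: a_minus_def quotient_add quotient_mult quotient_minus brace_distrib)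
qed

lemma quotient_lambda:
  assumes "a \<in> carrier B" "b \<in> carrier B"
  shows "brace_lambda Q (a <+ I) (b <+ I) = brace_lambda B a b <+ I"
  using assms
  by (simp add: brace_lambda_def quotient_add quotient_mult quotient_minus quotient_sel(1))

end

section \<open>Factorisations of a group by a skew left brace\<close>

text \<open>The internal form of a trifactorised group associated with a brace: only the factorisation
  \<open>G = KE\<close> is required, and the semidirect product is replaced by the rule for moving
  \<open>\<eta> c\<close> past \<open>\<delta> b\<close>.\<close>

locale brace_factorisation = skew_brace B
  for B :: "('a, 'b) ring_scheme" +
  fixes G :: "('g, 'm) monoid_scheme" and K E and \<delta> \<eta> :: "'a \<Rightarrow> 'g"
  assumes K: "K \<lhd> G" and E: "subgroup E G"
    and KE: "carrier G = K <#>\<^bsub>G\<^esub> E" and K_Int_E: "K \<inter> E = {\<one>\<^bsub>G\<^esub>}"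
    and delta: "\<delta> \<in> iso (add_monoid B) (G\<lparr>carrier := K\<rparr>)"
    and eta: "\<eta> \<in> epi B (G\<lparr>carrier := E\<rparr>)"
    and eta_delta: "\<And>c b. c \<in> carrier B \<Longrightarrow> b \<in> carrier B \<Longrightarrow>
      \<eta> c \<otimes>\<^bsub>G\<^esub> \<delta> b = \<delta> (brace_lambda B c b) \<otimes>\<^bsub>G\<^esub> \<eta> c"
begin

sublocale G: group G using K by (simp add: normal_def)
sublocale K: normal K G by (rule K)
sublocale E: subgroup E G by (rule E)

lemma delta_add:
  "a \<in> carrier B \<Longrightarrow> b \<in> carrier B \<Longrightarrow> \<delta> (a \<oplus>\<^bsub>B\<^esub> b) = \<delta> a \<otimes>\<^bsub>G\<^esub> \<delta> b"
  using delta by (auto simp: iso_def hom_def)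

lemma delta_bij: "bij_betw \<delta> (carrier B) K"
  using delta by (simp add: iso_def)

lemma delta_K: "a \<in> carrier B \<Longrightarrow> \<delta> a \<in> K"
  using delta_bij by (rule bij_betwE [rule_format])

lemma delta_surj: "k \<in> K \<Longrightarrow> \<exists>a\<in>carrier B. k = \<delta> a"
  using delta_bij by (auto simp: bij_betw_def)

lemma delta_inj: "\<delta> a = \<delta> b \<Longrightarrow> a \<in> carrier B \<Longrightarrow> b \<in> carrier B \<Longrightarrow> a = b"
  using delta_bij by (auto simp: bij_betw_def inj_on_def)

lemma eta_mult:
  "a \<in> carrier B \<Longrightarrow> b \<in> carrier B \<Longrightarrow> \<eta> (a \<otimes>\<^bsub>B\<^esub> b) = \<eta> a \<otimes>\<^bsub>G\<^esub> \<eta> b"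
  using eta by (auto simp: epi_def hom_def)

lemma eta_E: "a \<in> carrier B \<Longrightarrow> \<eta> a \<in> E"
  using eta by (auto simp: epi_def hom_def)

lemma eta_surj: "e \<in> E \<Longrightarrow> \<exists>a\<in>carrier B. e = \<eta> a"
  using eta by (auto simp: epi_def)

lemma delta_carrier [simp]: "a \<in> carrier B \<Longrightarrow> \<delta> a \<in> carrier G"
  and eta_carrier [simp]: "a \<in> carrier B \<Longrightarrow> \<eta> a \<in> carrier G"
  using delta_K eta_E by auto

lemma delta_zero: "\<delta> \<zero>\<^bsub>B\<^esub> = \<one>\<^bsub>G\<^esub>"
  using delta_add [of "\<zero>\<^bsub>B\<^esub>" "\<zero>\<^bsub>B\<^esub>"] by simp

lemma eta_one: "\<eta> \<one>\<^bsub>B\<^esub> = \<one>\<^bsub>G\<^esub>"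
  using eta_mult [of "\<one>\<^bsub>B\<^esub>" "\<one>\<^bsub>B\<^esub>"] by simp

lemma delta_minus: "a \<in> carrier B \<Longrightarrow> \<delta> (\<ominus>\<^bsub>B\<^esub> a) = inv\<^bsub>G\<^esub> \<delta> a"
  using delta_add [of "\<ominus>\<^bsub>B\<^esub> a" a] delta_zero by (intro G.inv_equality [symmetric]) auto

lemma eta_inv: "a \<in> carrier B \<Longrightarrow> \<eta> (inv\<^bsub>B\<^esub> a) = inv\<^bsub>G\<^esub> \<eta> a"
  using eta_mult [of "inv\<^bsub>B\<^esub> a" a] eta_one by (intro G.inv_equality [symmetric]) auto

text \<open>As \<open>\<delta>\<close> is injective, the commutation rule determines \<open>\<lambda>\<^sub>c\<close> from \<open>\<eta> c\<close>. Hence the kernel of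
  \<open>\<eta>\<close> acts trivially, and the induced action of \<open>E\<close> is well defined.\<close>

lemma lambda_unique:
  assumes "\<eta> c \<otimes>\<^bsub>G\<^esub> \<delta> b = \<delta> b' \<otimes>\<^bsub>G\<^esub> \<eta> c"
    and "c \<in> carrier B" "b \<in> carrier B" "b' \<in> carrier B"
  shows "brace_lambda B c b = b'"
  using assms eta_delta by (intro delta_inj) (simp_all)

lemma factor:
  "x \<in> carrier G \<Longrightarrow> \<exists>a\<in>carrier B. \<exists>c\<in>carrier B. x = \<delta> a \<otimes>\<^bsub>G\<^esub> \<eta> c"
  using delta_surj eta_surj unfolding KE set_mult_def by fast

lemma factor_unique:
  assumes a: "a \<in> carrier B" and e: "e \<in> E" and b: "b \<in> carrier B" and e': "e' \<in> E"
    and eq: "\<delta> a \<otimes>\<^bsub>G\<^esub> e = \<delta> b \<otimes>\<^bsub>G\<^esub> e'"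
  shows "a = b \<and> e = e'"
proof -
  have "inv\<^bsub>G\<^esub> \<delta> b \<otimes>\<^bsub>G\<^esub> \<delta> a = inv\<^bsub>G\<^esub> \<delta> b \<otimes>\<^bsub>G\<^esub> (\<delta> a \<otimes>\<^bsub>G\<^esub> e) \<otimes>\<^bsub>G\<^esub> inv\<^bsub>G\<^esub> e"
    using a b e by (simp add: G.m_assoc)
  also have "\<dots> = e' \<otimes>\<^bsub>G\<^esub> inv\<^bsub>G\<^esub> e"
    unfolding eq using b e e' by (simp add: G.m_assoc [symmetric])
  finally have "inv\<^bsub>G\<^esub> \<delta> b \<otimes>\<^bsub>G\<^esub> \<delta> a = e' \<otimes>\<^bsub>G\<^esub> inv\<^bsub>G\<^esub> e" .
  moreover have "inv\<^bsub>G\<^esub> \<delta> b \<otimes>\<^bsub>G\<^esub> \<delta> a \<in> K" using a b delta_K by simp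
  moreover have "e' \<otimes>\<^bsub>G\<^esub> inv\<^bsub>G\<^esub> e \<in> E" using e e' by simp
  ultimately have "inv\<^bsub>G\<^esub> \<delta> b \<otimes>\<^bsub>G\<^esub> \<delta> a \<in> K \<inter> E" by simp
  then have "inv\<^bsub>G\<^esub> \<delta> b \<otimes>\<^bsub>G\<^esub> \<delta> a = \<one>\<^bsub>G\<^esub>" using K_Int_E by simp
  then have "\<delta> a = \<delta> b" using a b G.inv_solve_left' [of "\<one>\<^bsub>G\<^esub>" "\<delta> b" "\<delta> a"] by simp
  then show ?thesis
    using eq a b e e' delta_inj by simp
qed

text \<open>The diagonal map \<open>c \<mapsto> \<delta> c \<cdot> \<eta> c\<close> is multiplicative because \<open>ab = a + \<lambda>\<^sub>a b\<close>, so its image is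
  a subgroup. It complements \<open>E\<close> and, together with \<open>K\<close>, generates \<open>G\<close>, because a diagonal element
  has any prescribed component in \<open>K\<close>, respectively in \<open>E\<close>.\<close>

theorem brace_trifactorised_group:
  "brace_trifactorised_group B G K {\<delta> c \<otimes>\<^bsub>G\<^esub> \<eta> c | c. c \<in> carrier B} E \<delta> \<eta>"
proof -
  define \<gamma> where "\<gamma> = (\<lambda>c. \<delta> c \<otimes>\<^bsub>G\<^esub> \<eta> c)"
  have "group_hom B G \<gamma>"
  proof (unfold_locales, rule homI)
    fix a b assume ab: "a \<in> carrier B" "b \<in> carrier B"
    have "\<gamma> (a \<otimes>\<^bsub>B\<^esub> b) = \<delta> a \<otimes>\<^bsub>G\<^esub> (\<delta> (brace_lambda B a b) \<otimes>\<^bsub>G\<^esub> \<eta> a) \<otimes>\<^bsub>G\<^esub> \<eta> b"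
      using ab eta_mult by (simp add: \<gamma>_def mult_eq_add_lambda [of a b] delta_add G.m_assoc flip: eta_mult)
    also have "\<dots> = \<gamma> a \<otimes>\<^bsub>G\<^esub> \<gamma> b"
      using ab by (simp add: \<gamma>_def G.m_assoc flip: eta_delta)
    finally show "\<gamma> (a \<otimes>\<^bsub>B\<^esub> b) = \<gamma> a \<otimes>\<^bsub>G\<^esub> \<gamma> b" .
  qed (simp add: \<gamma>_def)
  then interpret \<gamma>: group_hom B G \<gamma> .
  define H where "H = \<gamma> ` carrier B"
  have subH: "subgroup H G" unfolding H_def by (rule \<gamma>.img_is_subgroup)
  interpret H: subgroup H G by (rule subH)
  have KH: "carrier G = K <#>\<^bsub>G\<^esub> H"
  proof
    show "K <#>\<^bsub>G\<^esub> H \<subseteq> carrier G" by (auto simp: set_mult_def)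
    show "carrier G \<subseteq> K <#>\<^bsub>G\<^esub> H"
    proof
      fix x assume "x \<in> carrier G"
      then obtain a c where ac: "a \<in> carrier B" "c \<in> carrier B" "x = \<delta> a \<otimes>\<^bsub>G\<^esub> \<eta> c"
        using factor by blast
      then have "x = (\<delta> a \<otimes>\<^bsub>G\<^esub> inv\<^bsub>G\<^esub> \<delta> c) \<otimes>\<^bsub>G\<^esub> \<gamma> c"
        by (simp add: \<gamma>_def G.m_assoc G.inv_solve_left)
      then show "x \<in> K <#>\<^bsub>G\<^esub> H"
        using ac delta_K unfolding set_mult_def H_def by blast
    qed
  qed
  have HE: "carrier G = H <#>\<^bsub>G\<^esub> E"
  proof
    show "H <#>\<^bsub>G\<^esub> E \<subseteq> carrier G" by (auto simp: set_mult_def)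
    show "carrier G \<subseteq> H <#>\<^bsub>G\<^esub> E"
    proof
      fix x assume "x \<in> carrier G"
      then obtain a c where ac: "a \<in> carrier B" "c \<in> carrier B" "x = \<delta> a \<otimes>\<^bsub>G\<^esub> \<eta> c"
        using factor by blast
      then have "\<eta> c = \<eta> a \<otimes>\<^bsub>G\<^esub> (inv\<^bsub>G\<^esub> \<eta> a \<otimes>\<^bsub>G\<^esub> \<eta> c)"
        by (simp flip: G.m_assoc)
      with ac have "x = \<gamma> a \<otimes>\<^bsub>G\<^esub> (inv\<^bsub>G\<^esub> \<eta> a \<otimes>\<^bsub>G\<^esub> \<eta> c)"
        by (simp add: \<gamma>_def G.m_assoc)
      then show "x \<in> H <#>\<^bsub>G\<^esub> E"
        using ac eta_E unfolding set_mult_def H_def by blast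
    qed
  qed
  have "x = \<one>\<^bsub>G\<^esub>" if xH: "x \<in> H" and xE: "x \<in> E" for x
  proof -
    obtain c where c: "c \<in> carrier B" "x = \<delta> c \<otimes>\<^bsub>G\<^esub> \<eta> c" using xH by (auto simp: H_def \<gamma>_def)
    then have "\<delta> c = x \<otimes>\<^bsub>G\<^esub> inv\<^bsub>G\<^esub> \<eta> c" by (simp add: G.m_assoc)
    moreover have "x \<otimes>\<^bsub>G\<^esub> inv\<^bsub>G\<^esub> \<eta> c \<in> E" using c xE eta_E by blast
    ultimately have "\<delta> c \<in> K \<inter> E" using c delta_K by simp
    then have "\<delta> c = \<delta> \<zero>\<^bsub>B\<^esub>" using K_Int_E delta_zero by simp
    then have "c = \<zero>\<^bsub>B\<^esub>" by (rule delta_inj) (use c in auto)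
    then show ?thesis
      using c eta_one by (simp add: delta_zero one_eq_zero)
  qed
  then have H_Int_E: "H \<inter> E = {\<one>\<^bsub>G\<^esub>}" by auto
  have kernel: "kernel B (G\<lparr>carrier := E\<rparr>) \<eta> \<subseteq> kernel B (AutoGroup (add_monoid B)) (brace_lambda B)"
  proof
    fix c assume "c \<in> kernel B (G\<lparr>carrier := E\<rparr>) \<eta>"
    then have c: "c \<in> carrier B" "\<eta> c = \<one>\<^bsub>G\<^esub>" by (auto simp: kernel_def)
    have "brace_lambda B c b = b" if "b \<in> carrier B" for b
      using that c by (intro lambda_unique) auto
    then have "brace_lambda B c = (\<lambda>b\<in>carrier B. b)"
      by (auto simp: brace_lambda_def)
    then show "c \<in> kernel B (AutoGroup (add_monoid B)) (brace_lambda B)"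
      using c by (simp add: kernel_def AutoGroup_def BijGroup_def)
  qed
  have action: "induced_action B \<eta> (\<eta> c) = brace_lambda B c" if c: "c \<in> carrier B" for c
  proof -
    have "brace_lambda B c' = brace_lambda B c" if c': "c' \<in> carrier B" "\<eta> c' = \<eta> c" for c'
    proof
      fix b
      show "brace_lambda B c' b = brace_lambda B c b"
      proof (cases "b \<in> carrier B")
        case True
        then show ?thesis using c c' eta_delta [of c b] by (intro lambda_unique) auto
      qed (simp add: brace_lambda_def)
    qed
    then have "brace_lambda B ` {c' \<in> carrier B. \<eta> c' = \<eta> c} = {brace_lambda B c}"
      using c by blast
    then show ?thesis by (simp add: induced_action_def)
  qed
  have semidirect: "(\<lambda>(k, e). \<delta> k \<otimes>\<^bsub>G\<^esub> e)
    \<in> iso (semidirect_product (add_monoid B) (G\<lparr>carrier := E\<rparr>) (induced_action B \<eta>)) G"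
  proof (rule isoI)
    show "(\<lambda>(k, e). \<delta> k \<otimes>\<^bsub>G\<^esub> e)
      \<in> hom (semidirect_product (add_monoid B) (G\<lparr>carrier := E\<rparr>) (induced_action B \<eta>)) G"
    proof (rule homI, clarsimp simp: semidirect_product_def, clarsimp simp: semidirect_product_def)
      fix a e b e'
      assume a: "a \<in> carrier B" and "e \<in> E" and b: "b \<in> carrier B" and e': "e' \<in> E"
      then obtain c where c: "c \<in> carrier B" "e = \<eta> c" using eta_surj by blast
      show "\<delta> (a \<oplus>\<^bsub>B\<^esub> induced_action B \<eta> e b) \<otimes>\<^bsub>G\<^esub> (e \<otimes>\<^bsub>G\<^esub> e')
        = \<delta> a \<otimes>\<^bsub>G\<^esub> e \<otimes>\<^bsub>G\<^esub> (\<delta> b \<otimes>\<^bsub>G\<^esub> e')"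
      proof -
        have "\<delta> (a \<oplus>\<^bsub>B\<^esub> induced_action B \<eta> e b) \<otimes>\<^bsub>G\<^esub> (e \<otimes>\<^bsub>G\<^esub> e')
            = \<delta> a \<otimes>\<^bsub>G\<^esub> (\<delta> (brace_lambda B c b) \<otimes>\<^bsub>G\<^esub> \<eta> c) \<otimes>\<^bsub>G\<^esub> e'"
          using a b c e' by (simp add: action delta_add G.m_assoc)
        also have "\<dots> = \<delta> a \<otimes>\<^bsub>G\<^esub> (\<eta> c \<otimes>\<^bsub>G\<^esub> \<delta> b) \<otimes>\<^bsub>G\<^esub> e'"
          using b c eta_delta by simp
        finally show ?thesis
          using a b c e' by (simp add: G.m_assoc)
      qed
    qed
    show "bij_betw (\<lambda>(k, e). \<delta> k \<otimes>\<^bsub>G\<^esub> e)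
      (carrier (semidirect_product (add_monoid B) (G\<lparr>carrier := E\<rparr>) (induced_action B \<eta>)))
      (carrier G)"
    proof (rule bij_betw_imageI)
      show "inj_on (\<lambda>(k, e). \<delta> k \<otimes>\<^bsub>G\<^esub> e)
        (carrier (semidirect_product (add_monoid B) (G\<lparr>carrier := E\<rparr>) (induced_action B \<eta>)))"
        using factor_unique by (intro inj_onI) (auto simp: semidirect_product_def)
      show "(\<lambda>(k, e). \<delta> k \<otimes>\<^bsub>G\<^esub> e) `
        carrier (semidirect_product (add_monoid B) (G\<lparr>carrier := E\<rparr>) (induced_action B \<eta>))
        = carrier G"
        using factor eta_E by (auto simp: semidirect_product_def image_iff) fastforce
    qed
  qed
  have H_eq: "H = {\<delta> c \<otimes>\<^bsub>G\<^esub> \<eta> c | c. c \<in> carrier B}" by (auto simp: H_def \<gamma>_def)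
  have "brace_trifactorised_group B G K H E \<delta> \<eta>"
    by unfold_locales
      (fact subH KE KH HE K_Int_E H_Int_E delta eta kernel semidirect H_eq H.subset)+
  then show ?thesis unfolding H_eq .
qed

end

text \<open>
  Conversely, the commutation rule in \<open>G\<close> is the product of \<open>(0, \<eta> c)\<close> and \<open>(b, 1)\<close> in the
  semidirect product. Reading it off requires that the induced action of \<open>\<eta> c\<close> is \<open>\<lambda>\<^sub>c\<close>, which is
  where the condition on the kernel of \<open>\<eta>\<close> enters.
\<close>

lemma (in brace_trifactorised_group) brace_factorisation: "brace_factorisation B G K E \<delta> \<eta>"
proof (intro brace_factorisation.intro brace_factorisation_axioms.intro)
  interpret G: group G using K_normal by (simp add: normal_def)
  interpret K: normal K G by (rule K_normal)
  interpret E: subgroup E G by (rule E_subgroup)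
  fix c b assume c: "c \<in> carrier B" and b: "b \<in> carrier B"
  have eta_mult: "\<eta> (x \<otimes>\<^bsub>B\<^esub> y) = \<eta> x \<otimes>\<^bsub>G\<^esub> \<eta> y" if "x \<in> carrier B" "y \<in> carrier B" for x y
    using eta_epi that by (auto simp: epi_def hom_def)
  have eta_E: "\<eta> x \<in> E" if "x \<in> carrier B" for x
    using eta_epi that by (auto simp: epi_def hom_def)
  have delta_add: "\<delta> (x \<oplus>\<^bsub>B\<^esub> y) = \<delta> x \<otimes>\<^bsub>G\<^esub> \<delta> y" if "x \<in> carrier B" "y \<in> carrier B" for x y
    using delta_iso that by (auto simp: iso_def hom_def)
  have delta_K: "\<delta> x \<in> K" if "x \<in> carrier B" for x
    using delta_iso that by (auto simp: iso_def hom_def)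
  have [simp]: "\<delta> x \<in> carrier G" "\<eta> x \<in> carrier G" if "x \<in> carrier B" for x
    using that eta_E delta_K by auto
  have delta_zero: "\<delta> \<zero>\<^bsub>B\<^esub> = \<one>\<^bsub>G\<^esub>"
    using delta_add [of "\<zero>\<^bsub>B\<^esub>" "\<zero>\<^bsub>B\<^esub>"] by simp
  have lambda_eqI: "brace_lambda B c' = brace_lambda B c"
    if c': "c' \<in> carrier B" "\<eta> c' = \<eta> c" for c'
  proof
    fix x
    define z where "z = inv\<^bsub>B\<^esub> c \<otimes>\<^bsub>B\<^esub> c'"
    have z: "z \<in> carrier B" "c' = c \<otimes>\<^bsub>B\<^esub> z"
      using c c' by (simp_all add: z_def mul.m_assoc [symmetric])
    then have "\<eta> z = \<one>\<^bsub>G\<^esub>" using c c' eta_mult [of c z] by simp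
    with z have "z \<in> kernel B (AutoGroup (add_monoid B)) (brace_lambda B)"
      using kernel_eta by (auto simp: kernel_def)
    then have "brace_lambda B z = (\<lambda>x\<in>carrier B. x)"
      by (simp add: kernel_def AutoGroup_def BijGroup_def)
    then show "brace_lambda B c' x = brace_lambda B c x"
      using z c lambda_mult [of c z x] by (cases "x \<in> carrier B") (auto simp: brace_lambda_def)
  qed
  then have "brace_lambda B ` {c' \<in> carrier B. \<eta> c' = \<eta> c} = {brace_lambda B c}"
    using c by blast
  then have action: "induced_action B \<eta> (\<eta> c) = brace_lambda B c"
    by (simp add: induced_action_def)
  let ?S = "semidirect_product (add_monoid B) (G\<lparr>carrier := E\<rparr>) (induced_action B \<eta>)"
  let ?f = "\<lambda>(k, e). \<delta> k \<otimes>\<^bsub>G\<^esub> e"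
  have "?f ((\<zero>\<^bsub>B\<^esub>, \<eta> c) \<otimes>\<^bsub>?S\<^esub> (b, \<one>\<^bsub>G\<^esub>)) = ?f (\<zero>\<^bsub>B\<^esub>, \<eta> c) \<otimes>\<^bsub>G\<^esub> ?f (b, \<one>\<^bsub>G\<^esub>)"
    using semidirect b c eta_E add.one_closed E.one_closed
    unfolding iso_def by (intro hom_mult [of ?f ?S G]) (auto simp: semidirect_product_def)
  then show "\<eta> c \<otimes>\<^bsub>G\<^esub> \<delta> b = \<delta> (brace_lambda B c b) \<otimes>\<^bsub>G\<^esub> \<eta> c"
    using b c by (simp add: semidirect_product_def action delta_zero)
qed (fact skew_brace_axioms K_normal E_subgroup factor_KE K_Int_E delta_iso eta_epi)+

section \<open>The quotient by an ideal\<close>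

locale brace_factorisation_ideal =
  brace_factorisation B G K E \<delta> \<eta> + skew_brace_ideal B I
  for B :: "('a, 'b) ring_scheme" and G :: "('g, 'm) monoid_scheme" and K E \<delta> \<eta> I
begin

text \<open>The intersection \<open>LH \<inter> LE\<close> in explicit form, see \<open>T_eq_Int\<close>.\<close>

definition T :: "'g set"
  where "T = {\<delta> a \<otimes>\<^bsub>G\<^esub> \<eta> b | a b. a \<in> I \<and> b \<in> I}"

lemma T_I: "a \<in> I \<Longrightarrow> b \<in> I \<Longrightarrow> \<delta> a \<otimes>\<^bsub>G\<^esub> \<eta> b \<in> T"
  by (auto simp: T_def)

lemma delta_T: "a \<in> I \<Longrightarrow> \<delta> a \<in> T"
  using T_I [of a "\<one>\<^bsub>B\<^esub>"] mul.one_closed by (simp add: eta_one)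

lemma eta_T: "b \<in> I \<Longrightarrow> \<eta> b \<in> T"
  using T_I [of "\<zero>\<^bsub>B\<^esub>" b] add.one_closed by (simp add: delta_zero)

lemma delta_eta_in_T_D:
  assumes "\<delta> a \<otimes>\<^bsub>G\<^esub> e \<in> T" "a \<in> carrier B" "e \<in> E"
  shows "a \<in> I \<and> e \<in> \<eta> ` I"
proof -
  obtain a' b where ab: "a' \<in> I" "b \<in> I" "\<delta> a \<otimes>\<^bsub>G\<^esub> e = \<delta> a' \<otimes>\<^bsub>G\<^esub> \<eta> b"
    using assms by (auto simp: T_def)
  then have "a = a' \<and> e = \<eta> b"
    using assms by (intro factor_unique) (auto simp: eta_E)
  then show ?thesis using ab by blast
qed

text \<open>Both \<open>\<delta> a \<cdot> (\<delta> c \<cdot> \<eta> c) = \<delta> (a + c) \<cdot> \<eta> c\<close> and an element \<open>\<delta> a' \<cdot> e\<close> of \<open>LE\<close> are displayed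
  in the form \<open>KE\<close>, so when they agree, \<open>a + c = a'\<close> and hence \<open>c \<in> I\<close>. Conversely,
  \<open>\<delta> a \<cdot> \<eta> b = \<delta> (a - b) \<cdot> (\<delta> b \<cdot> \<eta> b)\<close>.\<close>

lemma T_eq_Int:
  assumes H: "H = {\<delta> c \<otimes>\<^bsub>G\<^esub> \<eta> c | c. c \<in> carrier B}"
  shows "(\<delta> ` I <#>\<^bsub>G\<^esub> H) \<inter> (\<delta> ` I <#>\<^bsub>G\<^esub> E) = T"
proof (intro equalityI subsetI)
  fix x assume "x \<in> T"
  then obtain a b where ab: "a \<in> I" "b \<in> I" "x = \<delta> a \<otimes>\<^bsub>G\<^esub> \<eta> b" by (auto simp: T_def)
  have "\<delta> (a \<oplus>\<^bsub>B\<^esub> (\<ominus>\<^bsub>B\<^esub> b)) \<otimes>\<^bsub>G\<^esub> (\<delta> b \<otimes>\<^bsub>G\<^esub> \<eta> b) = \<delta> (a \<oplus>\<^bsub>B\<^esub> (\<ominus>\<^bsub>B\<^esub> b) \<oplus>\<^bsub>B\<^esub> b) \<otimes>\<^bsub>G\<^esub> \<eta> b"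
    using ab by (simp add: delta_add G.m_assoc)
  also have "\<dots> = x"
    using ab by (simp add: add.m_assoc)
  finally have "x = \<delta> (a \<oplus>\<^bsub>B\<^esub> (\<ominus>\<^bsub>B\<^esub> b)) \<otimes>\<^bsub>G\<^esub> (\<delta> b \<otimes>\<^bsub>G\<^esub> \<eta> b)" ..
  moreover have "a \<oplus>\<^bsub>B\<^esub> (\<ominus>\<^bsub>B\<^esub> b) \<in> I" using ab by simp
  moreover have "\<delta> b \<otimes>\<^bsub>G\<^esub> \<eta> b \<in> H" using ab H by auto
  ultimately have "x \<in> \<delta> ` I <#>\<^bsub>G\<^esub> H" unfolding set_mult_def by blast
  moreover have "x \<in> \<delta> ` I <#>\<^bsub>G\<^esub> E"
    using ab eta_E [of b] unfolding set_mult_def by auto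
  ultimately show "x \<in> (\<delta> ` I <#>\<^bsub>G\<^esub> H) \<inter> (\<delta> ` I <#>\<^bsub>G\<^esub> E)" by blast
next
  fix x assume x: "x \<in> (\<delta> ` I <#>\<^bsub>G\<^esub> H) \<inter> (\<delta> ` I <#>\<^bsub>G\<^esub> E)"
  then obtain a c where ac: "a \<in> I" "c \<in> carrier B" "x = \<delta> a \<otimes>\<^bsub>G\<^esub> (\<delta> c \<otimes>\<^bsub>G\<^esub> \<eta> c)"
    unfolding set_mult_def H by blast
  obtain a' e where ae: "a' \<in> I" "e \<in> E" "x = \<delta> a' \<otimes>\<^bsub>G\<^esub> e"
    using x unfolding set_mult_def by blast
  have "\<delta> (a \<oplus>\<^bsub>B\<^esub> c) \<otimes>\<^bsub>G\<^esub> \<eta> c = \<delta> a' \<otimes>\<^bsub>G\<^esub> e"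
    using ac ae by (simp add: delta_add G.m_assoc)
  then have eq: "a \<oplus>\<^bsub>B\<^esub> c = a' \<and> \<eta> c = e"
    using ac ae by (intro factor_unique) (auto simp: eta_E)
  then have "c = \<ominus>\<^bsub>B\<^esub> a \<oplus>\<^bsub>B\<^esub> a'"
    using ac by (auto simp: add.m_assoc [symmetric])
  then have "c \<in> I" using ac ae by simp
  then show "x \<in> T" using ae eq T_I by auto
qed

text \<open>Since \<open>G = KE\<close>, invariance under conjugation can be checked for \<open>\<eta> c\<close> and \<open>\<delta> k\<close>
  separately. Conjugating by \<open>\<delta> k\<close> gives
  \<open>\<delta> k \<cdot> \<delta> a \<cdot> \<eta> b \<cdot> \<delta> (-k) = \<delta> (k + a + \<lambda>\<^sub>b (-k)) \<cdot> \<eta> b\<close>, and \<open>\<lambda>\<^sub>b (-k)\<close> is congruent to \<open>-k\<close>.\<close>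

lemma T_normal: "T \<lhd> G"
proof -
  have sub: "subgroup T G"
  proof (rule G.subgroupI)
    show "T \<subseteq> carrier G" by (auto simp: T_def)
    show "T \<noteq> {}" using delta_T [of "\<zero>\<^bsub>B\<^esub>"] add.one_closed by auto
  next
    fix x assume "x \<in> T"
    then obtain a b where ab: "a \<in> I" "b \<in> I" "x = \<delta> a \<otimes>\<^bsub>G\<^esub> \<eta> b" by (auto simp: T_def)
    have "inv\<^bsub>G\<^esub> x = \<eta> (inv\<^bsub>B\<^esub> b) \<otimes>\<^bsub>G\<^esub> \<delta> (\<ominus>\<^bsub>B\<^esub> a)"
      using ab by (simp add: G.inv_mult_group eta_inv delta_minus)
    also have "\<dots> = \<delta> (brace_lambda B (inv\<^bsub>B\<^esub> b) (\<ominus>\<^bsub>B\<^esub> a)) \<otimes>\<^bsub>G\<^esub> \<eta> (inv\<^bsub>B\<^esub> b)"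
      using ab by (intro eta_delta) auto
    also have "\<dots> \<in> T" using ab by (intro T_I lambda_ideal) auto
    finally show "inv\<^bsub>G\<^esub> x \<in> T" .
  next
    fix x y assume "x \<in> T" "y \<in> T"
    then obtain a b c d where ab: "a \<in> I" "b \<in> I" "x = \<delta> a \<otimes>\<^bsub>G\<^esub> \<eta> b"
        and cd: "c \<in> I" "d \<in> I" "y = \<delta> c \<otimes>\<^bsub>G\<^esub> \<eta> d"
      by (auto simp: T_def)
    have "x \<otimes>\<^bsub>G\<^esub> y = \<delta> a \<otimes>\<^bsub>G\<^esub> (\<eta> b \<otimes>\<^bsub>G\<^esub> \<delta> c) \<otimes>\<^bsub>G\<^esub> \<eta> d"
      using ab cd by (simp add: G.m_assoc)
    also have "\<dots> = \<delta> (a \<oplus>\<^bsub>B\<^esub> brace_lambda B b c) \<otimes>\<^bsub>G\<^esub> \<eta> (b \<otimes>\<^bsub>B\<^esub> d)"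
      using ab cd by (simp add: eta_delta delta_add eta_mult G.m_assoc)
    also have "\<dots> \<in> T" using ab cd by (intro T_I) (auto simp: lambda_ideal)
    finally show "x \<otimes>\<^bsub>G\<^esub> y \<in> T" .
  qed
  interpret T: subgroup T G by (rule sub)
  have conj_eta: "\<eta> c \<otimes>\<^bsub>G\<^esub> x \<otimes>\<^bsub>G\<^esub> inv\<^bsub>G\<^esub> \<eta> c \<in> T" if c: "c \<in> carrier B" and x: "x \<in> T" for c x
  proof -
    obtain a b where ab: "a \<in> I" "b \<in> I" "x = \<delta> a \<otimes>\<^bsub>G\<^esub> \<eta> b" using x by (auto simp: T_def)
    have "\<eta> c \<otimes>\<^bsub>G\<^esub> x \<otimes>\<^bsub>G\<^esub> inv\<^bsub>G\<^esub> \<eta> c = (\<eta> c \<otimes>\<^bsub>G\<^esub> \<delta> a) \<otimes>\<^bsub>G\<^esub> \<eta> b \<otimes>\<^bsub>G\<^esub> inv\<^bsub>G\<^esub> \<eta> c"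
      using ab c by (simp add: G.m_assoc)
    also have "\<dots> = \<delta> (brace_lambda B c a) \<otimes>\<^bsub>G\<^esub> \<eta> (c \<otimes>\<^bsub>B\<^esub> b \<otimes>\<^bsub>B\<^esub> inv\<^bsub>B\<^esub> c)"
      using ab c by (simp add: eta_delta eta_mult eta_inv G.m_assoc)
    also have "\<dots> \<in> T"
      using ab c by (intro T_I lambda_ideal mul.inv_op_closed2)
    finally show ?thesis .
  qed
  have conj_delta: "\<delta> k \<otimes>\<^bsub>G\<^esub> x \<otimes>\<^bsub>G\<^esub> inv\<^bsub>G\<^esub> \<delta> k \<in> T" if k: "k \<in> carrier B" and x: "x \<in> T" for k x
  proof -
    obtain a b where ab: "a \<in> I" "b \<in> I" "x = \<delta> a \<otimes>\<^bsub>G\<^esub> \<eta> b" using x by (auto simp: T_def)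
    define l where "l = brace_lambda B b (\<ominus>\<^bsub>B\<^esub> k)"
    have l: "l \<in> carrier B" using ab k by (auto simp: l_def)
    have "\<delta> k \<otimes>\<^bsub>G\<^esub> x \<otimes>\<^bsub>G\<^esub> inv\<^bsub>G\<^esub> \<delta> k = \<delta> k \<otimes>\<^bsub>G\<^esub> \<delta> a \<otimes>\<^bsub>G\<^esub> (\<eta> b \<otimes>\<^bsub>G\<^esub> \<delta> (\<ominus>\<^bsub>B\<^esub> k))"
      using ab k by (simp add: delta_minus G.m_assoc)
    also have "\<dots> = \<delta> (k \<oplus>\<^bsub>B\<^esub> a \<oplus>\<^bsub>B\<^esub> l) \<otimes>\<^bsub>G\<^esub> \<eta> b"
      using ab k l by (simp add: eta_delta delta_add G.m_assoc l_def)
    also have "\<dots> \<in> T"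
    proof (rule T_I)
      \<comment> \<open>a conjugate of \<open>a\<close>, plus the error term of \<open>\<lambda>\<^sub>b (-k)\<close> against \<open>-k\<close>\<close>
      have "(k \<oplus>\<^bsub>B\<^esub> a \<oplus>\<^bsub>B\<^esub> \<ominus>\<^bsub>B\<^esub> k) \<oplus>\<^bsub>B\<^esub> (\<ominus>\<^bsub>B\<^esub> (\<ominus>\<^bsub>B\<^esub> k) \<oplus>\<^bsub>B\<^esub> l) \<in> I"
        unfolding l_def using ab k
        by (intro add.m_closed add.inv_op_closed2 lambda_of_ideal) auto
      moreover have "k \<oplus>\<^bsub>B\<^esub> a \<oplus>\<^bsub>B\<^esub> l = (k \<oplus>\<^bsub>B\<^esub> a \<oplus>\<^bsub>B\<^esub> \<ominus>\<^bsub>B\<^esub> k) \<oplus>\<^bsub>B\<^esub> (k \<oplus>\<^bsub>B\<^esub> l)"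
      proof -
        have "\<ominus>\<^bsub>B\<^esub> k \<oplus>\<^bsub>B\<^esub> (k \<oplus>\<^bsub>B\<^esub> l) = l" using k l by (simp add: add.m_assoc [symmetric])
        then show ?thesis using ab k l by (simp add: add.m_assoc)
      qed
      ultimately show "k \<oplus>\<^bsub>B\<^esub> a \<oplus>\<^bsub>B\<^esub> l \<in> I" using k by simp
    qed (fact ab)
    finally show ?thesis .
  qed
  show ?thesis
    unfolding G.normal_inv_iff
  proof (intro conjI ballI)
    fix g x assume g: "g \<in> carrier G" and x: "x \<in> T"
    obtain k c where kc: "k \<in> carrier B" "c \<in> carrier B" "g = \<delta> k \<otimes>\<^bsub>G\<^esub> \<eta> c"
      using factor [OF g] by blast
    have "g \<otimes>\<^bsub>G\<^esub> x \<otimes>\<^bsub>G\<^esub> inv\<^bsub>G\<^esub> g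
        = \<delta> k \<otimes>\<^bsub>G\<^esub> (\<eta> c \<otimes>\<^bsub>G\<^esub> x \<otimes>\<^bsub>G\<^esub> inv\<^bsub>G\<^esub> \<eta> c) \<otimes>\<^bsub>G\<^esub> inv\<^bsub>G\<^esub> \<delta> k"
      using kc x by (simp add: G.inv_mult_group G.m_assoc)
    then show "g \<otimes>\<^bsub>G\<^esub> x \<otimes>\<^bsub>G\<^esub> inv\<^bsub>G\<^esub> g \<in> T"
      using conj_eta conj_delta kc x by simp
  qed (fact sub)
qed

sublocale T: normal T G by (rule T_normal)

text \<open>
  The maps \<open>k \<mapsto> \<delta> k T\<close> and \<open>c \<mapsto> \<eta> c T\<close> are constant on the cosets of \<open>I\<close> because \<open>\<delta>\<close> and
  \<open>\<eta>\<close> map \<open>I\<close> into \<open>T\<close>. Injectivity on the additive quotient, as well as the trivial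
  intersection of the images of \<open>K\<close> and \<open>E\<close>, comes from the fact that \<open>\<delta> a \<cdot> e \<in> T\<close> forces
  \<open>a \<in> I\<close>.
\<close>

lemma quotient_brace_factorisation:
  "\<exists>\<delta>' \<eta>'.
    (\<forall>k \<in> carrier B. \<delta>' (k <+\<^bsub>B\<^esub> I) = \<delta> k <#\<^bsub>G\<^esub> T) \<and>
    (\<forall>c \<in> carrier B. \<eta>' (c <#\<^bsub>B\<^esub> I) = \<eta> c <#\<^bsub>G\<^esub> T) \<and>
    brace_factorisation Q (G Mod T) (image_mod G K T) (image_mod G E T) \<delta>' \<eta>'"
proof -
  let ?p = "\<lambda>x. x <#\<^bsub>G\<^esub> T"
  have images: "image_mod G K T = ?p ` K" "image_mod G E T = ?p ` E"
    by (auto intro!: T.image_mod_eq K.subset E.subset)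
  interpret p: group_hom G "G Mod T" ?p
  proof (intro group_hom.intro group_hom_axioms.intro G.is_group T.factorgroup_is_group homI)
    show "?p x \<in> carrier (G Mod T)" if "x \<in> carrier G" for x
      using that by (auto simp: carrier_FactGroup T.coset_eq)
  qed (simp add: T.l_coset_mult)
  have p_surj: "?p ` carrier G = carrier (G Mod T)"
    by (simp add: carrier_FactGroup T.coset_eq)
  have p_one: "?p x = T" if "x \<in> T" for x
    using that G.coset_join3 [of x T] T.subgroup_axioms by simp
  have "I \<lhd> add_monoid B" "I \<lhd> B"
    using ideal by (simp_all add: brace_ideal_def)
  have delta_hom: "(\<lambda>a. ?p (\<delta> a)) \<in> hom (add_monoid B) ((G Mod T)\<lparr>carrier := ?p ` K\<rparr>)"
    by (rule homI) (auto simp: delta_K delta_add)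
  have delta_const: "?p (\<delta> a) = ?p (\<delta> b)"
    if "a \<in> carrier (add_monoid B)" "b \<in> carrier (add_monoid B)"
      "I #>\<^bsub>add_monoid B\<^esub> a = I #>\<^bsub>add_monoid B\<^esub> b" for a b
  proof -
    have "\<ominus>\<^bsub>B\<^esub> a \<oplus>\<^bsub>B\<^esub> b \<in> I"
      using that add.l_coset_eq_iff [of a b] add.coset_eq unfolding a_r_coset_def [symmetric] by simp
    then show ?thesis
      using that delta_T [of "\<ominus>\<^bsub>B\<^esub> a \<oplus>\<^bsub>B\<^esub> b"]
      by (simp add: T.l_coset_eq_iff delta_add delta_minus)
  qed
  obtain \<delta>' where delta'_hom: "\<delta>' \<in> hom (add_monoid B Mod I) ((G Mod T)\<lparr>carrier := ?p ` K\<rparr>)"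
      and delta'_r: "\<And>a. a \<in> carrier (add_monoid B) \<Longrightarrow> \<delta>' (I #>\<^bsub>add_monoid B\<^esub> a) = ?p (\<delta> a)"
    by (rule FactGroup_universal [OF delta_hom \<open>I \<lhd> add_monoid B\<close> delta_const]) (assumption+, rule that, assumption, blast)
  have eta_hom: "(\<lambda>a. ?p (\<eta> a)) \<in> hom B ((G Mod T)\<lparr>carrier := ?p ` E\<rparr>)"
    by (rule homI) (auto simp: eta_E eta_mult)
  have eta_const: "?p (\<eta> a) = ?p (\<eta> b)"
    if "a \<in> carrier B" "b \<in> carrier B" "I #>\<^bsub>B\<^esub> a = I #>\<^bsub>B\<^esub> b" for a b
  proof -
    have "inv\<^bsub>B\<^esub> a \<otimes>\<^bsub>B\<^esub> b \<in> I"
      using that mul.l_coset_eq_iff [of a b] mul.coset_eq by simp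
    then show ?thesis
      using that eta_T [of "inv\<^bsub>B\<^esub> a \<otimes>\<^bsub>B\<^esub> b"] by (simp add: T.l_coset_eq_iff eta_mult eta_inv)
  qed
  obtain \<eta>' where eta'_hom: "\<eta>' \<in> hom (B Mod I) ((G Mod T)\<lparr>carrier := ?p ` E\<rparr>)"
      and eta'_r: "\<And>a. a \<in> carrier B \<Longrightarrow> \<eta>' (I #>\<^bsub>B\<^esub> a) = ?p (\<eta> a)"
    by (rule FactGroup_universal [OF eta_hom \<open>I \<lhd> B\<close> eta_const]) (assumption+, rule that, assumption, blast)
  have delta': "\<delta>' (a <+\<^bsub>B\<^esub> I) = ?p (\<delta> a)" if "a \<in> carrier B" for a
    using delta'_r [of a] that add.coset_eq unfolding a_r_coset_def [symmetric] by simp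
  have eta': "\<eta>' (a <#\<^bsub>B\<^esub> I) = ?p (\<eta> a)" if "a \<in> carrier B" for a
    using eta'_r [OF that] that mul.coset_eq by simp
  have eta'_add: "\<eta>' (a <+\<^bsub>B\<^esub> I) = ?p (\<eta> a)" if "a \<in> carrier B" for a
    using eta' [OF that] that by (simp add: coset_eq_coset)
  have fac: "brace_factorisation Q (G Mod T) (?p ` K) (?p ` E) \<delta>' \<eta>'"
  proof (intro brace_factorisation.intro brace_factorisation_axioms.intro)
    show "skew_brace Q" by (rule skew_brace_quotient)
    show "?p ` K \<lhd> G Mod T"
      by (rule K.surj_hom_normal_subgroup [OF p.group_hom_axioms p_surj])
    show "subgroup (?p ` E) (G Mod T)"
      by (rule p.subgroup_img_is_subgroup [OF E])
    show "carrier (G Mod T) = ?p ` K <#>\<^bsub>G Mod T\<^esub> ?p ` E"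
    proof -
      have "carrier (G Mod T) = (\<Union>k\<in>K. \<Union>e\<in>E. {?p (k \<otimes>\<^bsub>G\<^esub> e)})"
        unfolding p_surj [symmetric] KE by (simp add: set_mult_def [of G K E] image_UN)
      also have "\<dots> = (\<Union>k\<in>K. \<Union>e\<in>E. {?p k \<otimes>\<^bsub>G Mod T\<^esub> ?p e})"
        by (intro SUP_cong refl) simp
      finally show ?thesis by (simp add: set_mult_def [of "G Mod T"])
    qed
    show "?p ` K \<inter> ?p ` E = {\<one>\<^bsub>G Mod T\<^esub>}"
    proof (intro equalityI subsetI)
      fix X assume "X \<in> ?p ` K \<inter> ?p ` E"
      then obtain a e where a: "a \<in> carrier B" "X = ?p (\<delta> a)" and e: "e \<in> E" "X = ?p e"
        using delta_surj by blast
      then have "inv\<^bsub>G\<^esub> \<delta> a \<otimes>\<^bsub>G\<^esub> e \<in> T"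
        using T.l_coset_eq_iff [of "\<delta> a" e] by simp
      then have "\<ominus>\<^bsub>B\<^esub> a \<in> I"
        using a e delta_eta_in_T_D [of "\<ominus>\<^bsub>B\<^esub> a" e] by (simp add: delta_minus)
      then have "\<ominus>\<^bsub>B\<^esub> (\<ominus>\<^bsub>B\<^esub> a) \<in> I" by (rule add.m_inv_closed)
      then have "a \<in> I" using a by simp
      then show "X \<in> {\<one>\<^bsub>G Mod T\<^esub>}" using a by (simp add: p_one delta_T)
    next
      fix X assume "X \<in> {\<one>\<^bsub>G Mod T\<^esub>}"
      then have "X = ?p \<one>\<^bsub>G\<^esub>" by (simp add: p_one)
      then show "X \<in> ?p ` K \<inter> ?p ` E"
        using subgroup.one_closed [OF K.subgroup_axioms] subgroup.one_closed [OF E] by blast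
    qed
    show "\<delta>' \<in> iso (add_monoid Q) ((G Mod T)\<lparr>carrier := ?p ` K\<rparr>)"
    proof (rule isoI)
      show "\<delta>' \<in> hom (add_monoid Q) ((G Mod T)\<lparr>carrier := ?p ` K\<rparr>)"
        unfolding quotient_add_group_eq by (rule delta'_hom)
      have "inj_on \<delta>' (carrier Q)"
      proof (rule inj_onI)
        fix X Y assume "X \<in> carrier Q" "Y \<in> carrier Q" and eq: "\<delta>' X = \<delta>' Y"
        then obtain a b where ab: "a \<in> carrier B" "X = a <+\<^bsub>B\<^esub> I" "b \<in> carrier B" "Y = b <+\<^bsub>B\<^esub> I"
          by (auto simp: quotient_sel)
        then have "\<delta> (\<ominus>\<^bsub>B\<^esub> a \<oplus>\<^bsub>B\<^esub> b) \<in> T"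
          using eq by (simp add: delta' T.l_coset_eq_iff delta_add delta_minus)
        then have "\<ominus>\<^bsub>B\<^esub> a \<oplus>\<^bsub>B\<^esub> b \<in> I"
          using ab delta_eta_in_T_D [of "\<ominus>\<^bsub>B\<^esub> a \<oplus>\<^bsub>B\<^esub> b" "\<one>\<^bsub>G\<^esub>"] by simp
        then show "X = Y" using ab by (simp add: add.l_coset_eq_iff)
      qed
      moreover have "\<delta>' ` carrier Q = ?p ` K"
        using delta_surj delta_K by (force simp: quotient_sel delta' image_image)
      ultimately show "bij_betw \<delta>' (carrier (add_monoid Q)) (carrier ((G Mod T)\<lparr>carrier := ?p ` K\<rparr>))"
        by (simp add: bij_betw_def)
    qed
    show "\<eta>' \<in> epi Q ((G Mod T)\<lparr>carrier := ?p ` E\<rparr>)"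
    proof -
      have "\<eta>' \<in> hom Q ((G Mod T)\<lparr>carrier := ?p ` E\<rparr>)"
        using eta'_hom unfolding quotient_mult_group_eq [symmetric]
        by (simp add: hom_def monoid.truncate_def)
      moreover have "\<eta>' ` carrier Q = ?p ` E"
        using eta_surj eta_E by (force simp: quotient_sel eta'_add image_image)
      ultimately show ?thesis by (simp add: epi_def)
    qed
    fix X Y assume "X \<in> carrier Q" "Y \<in> carrier Q"
    then obtain a b where ab: "a \<in> carrier B" "X = a <+\<^bsub>B\<^esub> I" "b \<in> carrier B" "Y = b <+\<^bsub>B\<^esub> I"
      by (auto simp: quotient_sel)
    then show "\<eta>' X \<otimes>\<^bsub>G Mod T\<^esub> \<delta>' Y = \<delta>' (brace_lambda Q X Y) \<otimes>\<^bsub>G Mod T\<^esub> \<eta>' X"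
      by (simp add: quotient_lambda eta'_add delta' T.l_coset_mult eta_delta del: p.hom_mult)
  qed
  show ?thesis
    unfolding images
    by (rule exI [of _ \<delta>'], rule exI [of _ \<eta>']) (intro conjI ballI delta' eta' fac)
qed

end

theorem proposition6p6:
  fixes B :: "('a, 'b) ring_scheme"
    and G :: "('g, 'm) monoid_scheme"
    and K H E L T :: "'g set"
    and I D :: "'a set"
    and \<delta> \<eta> :: "'a \<Rightarrow> 'g"
  assumes "brace_trifactorised_group B G K H E \<delta> \<eta>"
    and "brace_ideal I B"
    and "L = \<delta> ` I"
    and "T = (L <#>\<^bsub>G\<^esub> H) \<inter> (L <#>\<^bsub>G\<^esub> E)"
    and "D = {c \<in> carrier B. \<delta> c \<in> L}"
  shows "T \<lhd> G \<and>
    (\<exists>\<delta>' \<eta>'.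
      (\<forall>k \<in> carrier B. \<delta>' (k <+\<^bsub>B\<^esub> I) = \<delta> k <#\<^bsub>G\<^esub> T) \<and>
      (\<forall>c \<in> carrier B. \<eta>' (c <#\<^bsub>B\<^esub> D) = \<eta> c <#\<^bsub>G\<^esub> T) \<and>
      brace_trifactorised_group (brace_quotient B I) (G Mod T)
        (image_mod G K T) (image_mod G H T) (image_mod G E T) \<delta>' \<eta>')"
proof -
  interpret tri: brace_trifactorised_group B G K H E \<delta> \<eta> by fact
  interpret F: brace_factorisation_ideal B G K E \<delta> \<eta> I
    by (intro brace_factorisation_ideal.intro skew_brace_ideal.intro skew_brace_ideal_axioms.intro
        tri.brace_factorisation tri.skew_brace_axioms assms)
  have T: "T = F.T" using F.T_eq_Int [OF tri.H_eq] assms by simp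
  have D: "D = I" using assms F.delta_inj by (auto dest: F.mul.mem_carrier)
  obtain \<delta>' \<eta>' where
    delta': "\<And>k. k \<in> carrier B \<Longrightarrow> \<delta>' (k <+\<^bsub>B\<^esub> I) = \<delta> k <#\<^bsub>G\<^esub> T" and
    eta': "\<And>c. c \<in> carrier B \<Longrightarrow> \<eta>' (c <#\<^bsub>B\<^esub> D) = \<eta> c <#\<^bsub>G\<^esub> T" and
    fac: "brace_factorisation (brace_quotient B I) (G Mod T) (image_mod G K T) (image_mod G E T) \<delta>' \<eta>'"
    using F.quotient_brace_factorisation unfolding T D by blast
  have "H \<subseteq> carrier G" by (rule subgroup.subset [OF tri.H_subgroup])
  then have "image_mod G H T = (\<lambda>x. x <#\<^bsub>G\<^esub> T) ` H"
    unfolding T by (rule F.T.image_mod_eq)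
  also have "\<dots> = {\<delta>' X \<otimes>\<^bsub>G Mod T\<^esub> \<eta>' X | X. X \<in> carrier (brace_quotient B I)}"
  proof -
    have "\<delta>' (c <+\<^bsub>B\<^esub> I) \<otimes>\<^bsub>G Mod T\<^esub> \<eta>' (c <+\<^bsub>B\<^esub> I) = (\<delta> c \<otimes>\<^bsub>G\<^esub> \<eta> c) <#\<^bsub>G\<^esub> T"
      if "c \<in> carrier B" for c
      using that delta' eta' [unfolded D] F.coset_eq_coset F.T.l_coset_mult
      by (simp add: T [symmetric])
    then show ?thesis
      unfolding tri.H_eq F.quotient_sel by (auto simp: image_iff)
  qed
  finally have "brace_trifactorised_group (brace_quotient B I) (G Mod T)
      (image_mod G K T) (image_mod G H T) (image_mod G E T) \<delta>' \<eta>'"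
    using brace_factorisation.brace_trifactorised_group [OF fac] by simp
  then show ?thesis
    using F.T_normal delta' eta' unfolding T by blast
qed

end
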